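(* Let $p>1$ be a real number and let $G$ and $H$ be countably infinite, connected graphs of bounded degree without self-loops. If there is a rough isometry from $G$ to $H$, then $\partial_p(G)$ is homeomorphic to $\partial_p(H)$.
   Context: A graph is regarded as a metric space (on its vertex set) with the shortest path metric $d$, each edge having length one. A map $\phi\colon X\to Y$ between metric spaces is a rough isometry if (1) there are constants $a\ge1$, $b\ge0$ with $\frac1a d_X(x_1,x_2)-b\le d_Y(\phi(x_1),\phi(x_2))\le a\,d_X(x_1,x_2)+b$ for all $x_1,x_2\in X$, and (2) there is a constant $c>0$ such that for each $y\in Y$ there is $x\in X$ with $d_Y(\phi(x),y)<c$. For a graph $G$ with vertex set $V$, let $N_x$ be the set of neighbors of $x\in V$, and $o\in V$ a fixed vertex. Bounded degree means there is an integer $k$ with $\#N_x\le k$ for all $x$. For $f\colon V\to\mathbb{R}$ put $I_p(f,V)=\sum_{x\in V}\sum_{y\in N_x}|f(y)-f(x)|^p$. $D_p(G)=\{f\colon V\to\mathbb{R}\mid I_p(f,V)<\infty\}$ with norm $\|f\|_{D_p}=(I_p(f,V)+|f(o)|^p)^{1/p}$. $\ell^\infty(G)$ is the set of bounded real functions on $V$, and $BD_p(G)=D_p(G)\cap\ell^\infty(G)$, a commutative Banach algebra under pointwise multiplication with norm $\|f\|_{BD_p}=I_p(f,V)^{1/p}+\sup_V|f|$. $\mathbb{R}G$ is the set of finitely supported real functions on $V$, $(\overline{\mathbb{R}G})_{D_p}$ is its closure in $D_p(G)$, and $B(\overline{\mathbb{R}G})_{D_p}=(\overline{\mathbb{R}G})_{D_p}\cap\ell^\infty(G)$.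 $Sp(BD_p(G))$ is the set of nonzero algebra homomorphisms $BD_p(G)\to\mathbb{C}$ with the weak-$*$ topology (pointwise convergence on $BD_p(G)$), a compact Hausdorff space. For $f\in BD_p(G)$, $\hat f(\tau)=\tau(f)$. $V$ is identified with its image in $Sp(BD_p(G))$ under $x\mapsto(f\mapsto f(x))$. The $p$-Royden boundary is $R_p(G)=Sp(BD_p(G))\setminus V$, and the $p$-harmonic boundary, with the subspace topology, is $\partial_p(G)=\{x\in R_p(G)\mid \hat f(x)=0\text{ for all }f\in B(\overline{\mathbb{R}G})_{D_p}\}$. *)

theory Defs
  imports "HOL-Analysis.Analysis"
begin

text \<open>
  A graph is given by its adjacency relation \<open>E\<close>; its vertex set is the whole type \<open>'v\<close>.
  Only neighbour sets and path lengths enter below, so parallel edges need no representation.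
\<close>

definition nbrs :: "('v \<times> 'v) set \<Rightarrow> 'v \<Rightarrow> 'v set" where
  "nbrs E x = E `` {x}"

definition undirected :: "('v \<times> 'v) set \<Rightarrow> bool" where
  "undirected E \<longleftrightarrow> sym E"

definition no_self_loops :: "('v \<times> 'v) set \<Rightarrow> bool" where
  "no_self_loops E \<longleftrightarrow> irrefl E"

definition connected_graph :: "('v \<times> 'v) set \<Rightarrow> bool" where
  "connected_graph E \<longleftrightarrow> (\<forall>x y. (x, y) \<in> E\<^sup>*)"

definition bounded_degree :: "('v \<times> 'v) set \<Rightarrow> bool" where
  "bounded_degree E \<longleftrightarrow> (\<exists>k::nat. \<forall>x. finite (nbrs E x) \<and> card (nbrs E x) \<le> k)"

text \<open>Shortest path metric; meaningful for connected graphs.\<close>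

definition path_dist :: "('v \<times> 'v) set \<Rightarrow> 'v \<Rightarrow> 'v \<Rightarrow> real" where
  "path_dist E x y = real (LEAST n. (x, y) \<in> E ^^ n)"

definition rough_isometry ::
  "('x \<Rightarrow> 'x \<Rightarrow> real) \<Rightarrow> ('y \<Rightarrow> 'y \<Rightarrow> real) \<Rightarrow> ('x \<Rightarrow> 'y) \<Rightarrow> bool" where
  "rough_isometry dX dY \<phi> \<longleftrightarrow>
     (\<exists>a b. a \<ge> 1 \<and> b \<ge> 0 \<and>
        (\<forall>x1 x2. (1 / a) * dX x1 x2 - b \<le> dY (\<phi> x1) (\<phi> x2) \<and>
                 dY (\<phi> x1) (\<phi> x2) \<le> a * dX x1 x2 + b)) \<and>
     (\<exists>c>0. \<forall>y. \<exists>x. dY (\<phi> x) y < c)"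

text \<open>
  The inner sum is the one over neighbours of \<open>x\<close>, a finite set in graphs of bounded degree.
  Finiteness of \<open>I\<^sub>p(f, V)\<close> is summability of the outer family of nonnegative reals;
  \<open>dirichlet_sum\<close> is its value in that case.
\<close>

definition local_energy :: "real \<Rightarrow> ('v \<times> 'v) set \<Rightarrow> ('v \<Rightarrow> real) \<Rightarrow> 'v \<Rightarrow> real" where
  "local_energy p E f x = (\<Sum>y\<in>nbrs E x. \<bar>f y - f x\<bar> powr p)"

definition dirichlet_sum :: "real \<Rightarrow> ('v \<times> 'v) set \<Rightarrow> ('v \<Rightarrow> real) \<Rightarrow> real" where
  "dirichlet_sum p E f = (\<Sum>\<^sub>\<infinity>x\<in>UNIV. local_energy p E f x)"

definition Dp :: "real \<Rightarrow> ('v \<times> 'v) set \<Rightarrow> ('v \<Rightarrow> real) set" where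
  "Dp p E = {f. local_energy p E f summable_on UNIV}"

definition Dp_norm :: "real \<Rightarrow> ('v \<times> 'v) set \<Rightarrow> 'v \<Rightarrow> ('v \<Rightarrow> real) \<Rightarrow> real" where
  "Dp_norm p E v0 f = (dirichlet_sum p E f + \<bar>f v0\<bar> powr p) powr (1 / p)"

definition bounded_functions :: "('v \<Rightarrow> real) set" where
  "bounded_functions = {f. bounded (range f)}"

definition BDp :: "real \<Rightarrow> ('v \<times> 'v) set \<Rightarrow> ('v \<Rightarrow> real) set" where
  "BDp p E = Dp p E \<inter> bounded_functions"

definition finitely_supported :: "('v \<Rightarrow> real) set" where
  "finitely_supported = {f. finite {x. f x \<noteq> 0}}"

definition Dp_closure_finsupp :: "real \<Rightarrow> ('v \<times> 'v) set \<Rightarrow> 'v \<Rightarrow> ('v \<Rightarrow> real) set" where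
  "Dp_closure_finsupp p E v0 =
     {f \<in> Dp p E. \<forall>\<epsilon>>0. \<exists>g\<in>finitely_supported. Dp_norm p E v0 (\<lambda>x. f x - g x) < \<epsilon>}"

definition B_closure_finsupp :: "real \<Rightarrow> ('v \<times> 'v) set \<Rightarrow> 'v \<Rightarrow> ('v \<Rightarrow> real) set" where
  "B_closure_finsupp p E v0 = Dp_closure_finsupp p E v0 \<inter> bounded_functions"

text \<open>
  The spectrum consists of the nonzero homomorphisms of real algebras from \<open>BD\<^sub>p\<close> to the
  complex numbers.  A map with domain \<open>BD\<^sub>p\<close> is an \<open>extensional\<close> function on it, so that distinct
  elements of the spectrum differ on \<open>BD\<^sub>p\<close>.
\<close>

definition Sp :: "real \<Rightarrow> ('v \<times> 'v) set \<Rightarrow> (('v \<Rightarrow> real) \<Rightarrow> complex) set" where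
  "Sp p E = {\<tau> \<in> extensional (BDp p E).
     (\<forall>f\<in>BDp p E. \<forall>g\<in>BDp p E. \<tau> (\<lambda>x. f x + g x) = \<tau> f + \<tau> g) \<and>
     (\<forall>c::real. \<forall>f\<in>BDp p E. \<tau> (\<lambda>x. c * f x) = complex_of_real c * \<tau> f) \<and>
     (\<forall>f\<in>BDp p E. \<forall>g\<in>BDp p E. \<tau> (\<lambda>x. f x * g x) = \<tau> f * \<tau> g) \<and>
     (\<exists>f\<in>BDp p E. \<tau> f \<noteq> 0)}"

definition Sp_topology :: "real \<Rightarrow> ('v \<times> 'v) set \<Rightarrow> (('v \<Rightarrow> real) \<Rightarrow> complex) topology" where
  "Sp_topology p E = subtopology (product_topology (\<lambda>_. euclidean) (BDp p E)) (Sp p E)"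

definition point_eval :: "real \<Rightarrow> ('v \<times> 'v) set \<Rightarrow> 'v \<Rightarrow> (('v \<Rightarrow> real) \<Rightarrow> complex)" where
  "point_eval p E x = (\<lambda>f\<in>BDp p E. complex_of_real (f x))"

definition royden_boundary :: "real \<Rightarrow> ('v \<times> 'v) set \<Rightarrow> (('v \<Rightarrow> real) \<Rightarrow> complex) set" where
  "royden_boundary p E = Sp p E - range (point_eval p E)"

definition harmonic_boundary ::
  "real \<Rightarrow> ('v \<times> 'v) set \<Rightarrow> 'v \<Rightarrow> (('v \<Rightarrow> real) \<Rightarrow> complex) set" where
  "harmonic_boundary p E v0 =
     {\<tau> \<in> royden_boundary p E. \<forall>f\<in>B_closure_finsupp p E v0. \<tau> f = 0}"

definition harmonic_boundary_space ::
  "real \<Rightarrow> ('v \<times> 'v) set \<Rightarrow> 'v \<Rightarrow> (('v \<Rightarrow> real) \<Rightarrow> complex) topology" where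
  "harmonic_boundary_space p E v0 = subtopology (Sp_topology p E) (harmonic_boundary p E v0)"

end

theory Submission
  imports Defs
begin

text \<open>
  A rough isometry \<open>\<phi>\<close> from \<open>G\<close> to \<open>H\<close> has a rough inverse \<open>\<psi>\<close>, and both act on functions by
  composition.  The homeomorphism of harmonic boundaries is the adjoint of the algebra
  homomorphism \<open>f \<mapsto> f \<circ> \<phi>\<close>: it sends a character \<open>\<tau>\<close> of \<open>BD\<^sub>p(G)\<close> to \<open>f \<mapsto> \<tau> (f \<circ> \<phi>)\<close>, and its
  inverse is the adjoint of composition with \<open>\<psi>\<close>.

  Everything analytic rests on one estimate, \<open>displaced_sum_bound\<close>: if two families of vertices
  \<open>\<alpha> u\<close>, \<open>\<beta> u\<close> stay at bounded distance and \<open>\<alpha>\<close> takes each value boundedly often, then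
  \<open>\<Sum>u. \<bar>f (\<beta> u) - f (\<alpha> u)\<bar>\<^sup>p \<le> C I\<^sub>p(f)\<close>, because the difference telescopes along a short path and, in a
  graph of bounded degree, each edge is used by boundedly many of these paths.  Three choices of
  the index set give what is needed.

  \<^item> The edges of \<open>G\<close>, with the images of their two ends under \<open>\<phi>\<close>: composition with \<open>\<phi>\<close> maps
    \<open>D\<^sub>p(H)\<close> to \<open>D\<^sub>p(G)\<close> and multiplies the energy by at most a constant.
  \<^item> A single point: changing the base vertex changes the norm of \<open>D\<^sub>p\<close> to an equivalent one.  As
    fibres of \<open>\<phi>\<close> are finite, composition with \<open>\<phi>\<close> therefore maps the closure of the finitely
    supported functions on \<open>H\<close> into that on \<open>G\<close>, and the adjoint preserves the condition
    defining the harmonic boundary.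
  \<^item> The vertices \<open>x\<close> of \<open>G\<close>, paired with \<open>\<psi> (\<phi> x)\<close>: the function \<open>f \<circ> \<psi> \<circ> \<phi> - f\<close> lies in \<open>\<ell>\<^sup>p\<close>.
    Its truncations to finite sets converge in \<open>\<ell>\<^sup>p\<close>, hence in \<open>D\<^sub>p\<close>, so it is in the closure of the
    finitely supported functions.  A character in the harmonic boundary kills it and cannot
    distinguish \<open>f\<close> from \<open>f \<circ> \<psi> \<circ> \<phi>\<close>, so the two adjoints are mutually inverse there.

  The image of a character in the harmonic boundary is never a point evaluation, since
  evaluation at \<open>x\<close> does not vanish on the indicator function of \<open>x\<close>.
\<close>

section \<open>Maps with uniformly bounded fibres\<close>

definition bounded_fibres :: "'u set \<Rightarrow> ('u \<Rightarrow> 'v) \<Rightarrow> bool" where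
  "bounded_fibres U \<alpha> \<longleftrightarrow> (\<exists>M::nat. \<forall>z. finite {u \<in> U. \<alpha> u = z} \<and> card {u \<in> U. \<alpha> u = z} \<le> M)"

text \<open>
  A fibre of \<open>\<gamma>\<close> is covered by the fibres of \<open>\<alpha>\<close> over a set of bounded size.  This handles both
  compositions and maps that stay close to \<open>\<alpha>\<close>, where \<open>K\<close> is a preimage or a ball.
\<close>

lemma bounded_fibres_cover:
  assumes \<alpha>: "bounded_fibres U \<alpha>"
    and K: "\<And>z. finite (K z) \<and> card (K z) \<le> m"
    and cover: "\<And>u. u \<in> U \<Longrightarrow> \<alpha> u \<in> K (\<gamma> u)"
  shows "bounded_fibres U \<gamma>"
proof -
  obtain M where M: "\<And>z. finite {u \<in> U. \<alpha> u = z} \<and> card {u \<in> U. \<alpha> u = z} \<le> M"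
    using \<alpha> unfolding bounded_fibres_def by blast
  have "finite {u \<in> U. \<gamma> u = z} \<and> card {u \<in> U. \<gamma> u = z} \<le> m * M" for z
  proof -
    let ?B = "\<Union>w\<in>K z. {u \<in> U. \<alpha> u = w}"
    have sub: "{u \<in> U. \<gamma> u = z} \<subseteq> ?B" using cover by auto
    have fin: "finite ?B" using K M by blast
    have "card ?B \<le> (\<Sum>w\<in>K z. card {u \<in> U. \<alpha> u = w})"
      using K by (intro card_UN_le) auto
    also have "\<dots> \<le> card (K z) * M"
      using sum_bounded_above[of "K z" "\<lambda>w. card {u \<in> U. \<alpha> u = w}" M] M by auto
    also have "\<dots> \<le> m * M" using K by simp
    finally have "card ?B \<le> m * M" .
    with sub fin show ?thesis by (meson card_mono finite_subset le_trans)
  qed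
  then show ?thesis unfolding bounded_fibres_def by blast
qed

lemma bounded_fibres_comp:
  assumes "bounded_fibres U \<alpha>" and "bounded_fibres UNIV \<beta>"
  shows "bounded_fibres U (\<lambda>u. \<beta> (\<alpha> u))"
proof -
  obtain M where "\<And>z. finite {w \<in> UNIV. \<beta> w = z} \<and> card {w \<in> UNIV. \<beta> w = z} \<le> M"
    using assms(2) unfolding bounded_fibres_def by blast
  then show ?thesis
    by (intro bounded_fibres_cover[OF assms(1), of "\<lambda>z. {w \<in> UNIV. \<beta> w = z}" M]) auto
qed

lemma bounded_fibres_id: "bounded_fibres UNIV (\<lambda>x. x)"
  unfolding bounded_fibres_def by (intro exI[of _ 1]) auto

text \<open>
  The bound on \<open>h\<close> is imposed on finite partial sums, so that it applies equally to a local energy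
  and to \<open>\<bar>g\<bar>\<^sup>p\<close> without first establishing summability.
\<close>

lemma sum_comp_le_card_fibre_mult:
  fixes h :: "'v \<Rightarrow> real"
  assumes M: "\<And>z. finite {u \<in> U. \<alpha> u = z} \<and> card {u \<in> U. \<alpha> u = z} \<le> M"
    and h: "\<And>z. 0 \<le> h z" and B: "\<And>S. finite S \<Longrightarrow> sum h S \<le> B"
    and S: "finite S" "S \<subseteq> U"
  shows "(\<Sum>u\<in>S. h (\<alpha> u)) \<le> real M * B"
proof -
  have "(\<Sum>u\<in>S. h (\<alpha> u)) = (\<Sum>z\<in>\<alpha> ` S. \<Sum>u\<in>{u. u \<in> S \<and> \<alpha> u = z}. h (\<alpha> u))"
    by (rule sum.image_gen[OF S(1)])
  also have "\<dots> \<le> (\<Sum>z\<in>\<alpha> ` S. real M * h z)"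
  proof (rule sum_mono)
    fix z
    have "card {u. u \<in> S \<and> \<alpha> u = z} \<le> card {u \<in> U. \<alpha> u = z}"
      using M S by (intro card_mono) auto
    then have "card {u. u \<in> S \<and> \<alpha> u = z} \<le> M" using M[of z] by linarith
    then show "(\<Sum>u\<in>{u. u \<in> S \<and> \<alpha> u = z}. h (\<alpha> u)) \<le> real M * h z"
      using h by (simp add: mult_right_mono)
  qed
  also have "\<dots> = real M * sum h (\<alpha> ` S)" by (simp add: sum_distrib_left)
  also have "\<dots> \<le> real M * B" using B S by (intro mult_left_mono) auto
  finally show ?thesis .
qed

section \<open>Balls and path distance\<close>

text \<open>
  Membership of \<open>(x, y)\<close> in \<open>(E\<^sup>=) ^^ N\<close> expresses that \<open>x\<close> and \<open>y\<close> are at distance at most \<open>N\<close>: the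
  reflexive steps pad a shorter path.  A path then has a fixed length, which allows induction on
  \<open>N\<close>.
\<close>

lemma finite_ball:
  assumes "bounded_degree E"
  shows "\<exists>m. \<forall>x. finite (((E\<^sup>=) ^^ N) `` {x}) \<and> card (((E\<^sup>=) ^^ N) `` {x}) \<le> m"
proof -
  obtain k where k: "\<And>x. finite (nbrs E x) \<and> card (nbrs E x) \<le> k"
    using assms unfolding bounded_degree_def by blast
  show ?thesis
  proof (induction N)
    case 0
    show ?case by (intro exI[of _ 1]) simp
  next
    case (Suc N)
    then obtain m where m: "\<And>x. finite (((E\<^sup>=) ^^ N) `` {x}) \<and> card (((E\<^sup>=) ^^ N) `` {x}) \<le> m"
      by blast
    have "finite (((E\<^sup>=) ^^ Suc N) `` {x}) \<and> card (((E\<^sup>=) ^^ Suc N) `` {x}) \<le> m * (k + 1)" for x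
    proof -
      let ?K = "((E\<^sup>=) ^^ N) `` {x}"
      have eq: "((E\<^sup>=) ^^ Suc N) `` {x} = (\<Union>w\<in>?K. insert w (nbrs E w))"
        by (auto simp: nbrs_def)
      have "card (\<Union>w\<in>?K. insert w (nbrs E w)) \<le> (\<Sum>w\<in>?K. card (insert w (nbrs E w)))"
        using m by (intro card_UN_le) auto
      also have "\<dots> \<le> card ?K * (k + 1)"
      proof -
        have "card (insert w (nbrs E w)) \<le> k + 1" for w
          using k[of w] card_insert_le_m1[of "k + 1" "nbrs E w" w] by simp
        then show ?thesis
          using sum_bounded_above[of ?K "\<lambda>w. card (insert w (nbrs E w))" "k + 1"] by simp
      qed
      also have "\<dots> \<le> m * (k + 1)" using m by (intro mult_right_mono) auto
      finally show ?thesis unfolding eq using m k by blast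
    qed
    then show ?case by blast
  qed
qed

lemma sym_reflcl_relpow:
  assumes "sym E"
  shows "sym ((E\<^sup>=) ^^ N)"
proof -
  have s: "sym (E\<^sup>=)" using assms by (simp add: sym_Un sym_Id)
  show ?thesis
  proof (induction N)
    case 0
    show ?case by (simp add: sym_Id)
  next
    case (Suc N)
    show ?case
    proof (rule symI)
      fix a b assume "(a, b) \<in> (E\<^sup>=) ^^ Suc N"
      then obtain c where "(a, c) \<in> (E\<^sup>=) ^^ N" "(c, b) \<in> E\<^sup>=" by auto
      then have "(c, a) \<in> (E\<^sup>=) ^^ N" "(b, c) \<in> E\<^sup>="
        using Suc s by (meson symD)+
      then show "(b, a) \<in> (E\<^sup>=) ^^ Suc N" by (meson relpow_Suc_I2)
    qed
  qed
qed

lemma relpow_path_dist: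
  assumes "connected_graph E"
  shows "\<exists>n. path_dist E x y = real n \<and> (x, y) \<in> E ^^ n"
proof -
  have "\<exists>n. (x, y) \<in> E ^^ n"
    using assms unfolding connected_graph_def by (meson rtrancl_imp_relpow)
  then have "(x, y) \<in> E ^^ (LEAST n. (x, y) \<in> E ^^ n)" by (rule LeastI_ex)
  then show ?thesis unfolding path_dist_def by blast
qed

lemma path_dist_le: "(x, y) \<in> E ^^ n \<Longrightarrow> path_dist E x y \<le> real n"
  unfolding path_dist_def by (simp add: Least_le)

lemma path_dist_le_imp_reflcl_relpow:
  assumes "connected_graph E" and "path_dist E x y \<le> r"
  shows "(x, y) \<in> (E\<^sup>=) ^^ nat \<lceil>r\<rceil>"
proof -
  obtain n where n: "path_dist E x y = real n" "(x, y) \<in> E ^^ n"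
    using relpow_path_dist[OF assms(1)] by blast
  have le: "n \<le> nat \<lceil>r\<rceil>" using n assms(2) by linarith
  have "E ^^ n \<subseteq> (E\<^sup>=) ^^ n" by (induction n) auto
  then have 1: "(x, y) \<in> (E\<^sup>=) ^^ n" using n by blast
  have "(y, y) \<in> (E\<^sup>=) ^^ m" for m
    by (induction m) auto
  with 1 have "(x, y) \<in> (E\<^sup>=) ^^ (n + (nat \<lceil>r\<rceil> - n))"
    unfolding relpow_add by blast
  then show ?thesis using le by simp
qed

lemma path_dist_triangle:
  assumes "connected_graph E"
  shows "path_dist E x z \<le> path_dist E x y + path_dist E y z"
proof -
  obtain m n where "path_dist E x y = real m" "(x, y) \<in> E ^^ m"
      "path_dist E y z = real n" "(y, z) \<in> E ^^ n"
    using relpow_path_dist[OF assms] by meson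
  moreover from this have "(x, z) \<in> E ^^ (m + n)" unfolding relpow_add by blast
  ultimately show ?thesis using path_dist_le[of x z "m + n" E] by simp
qed

lemma path_dist_commute_le:
  assumes "connected_graph E" and "sym E"
  shows "path_dist E y x \<le> path_dist E x y"
proof -
  obtain n where n: "path_dist E x y = real n" "(x, y) \<in> E ^^ n"
    using relpow_path_dist[OF assms(1)] by blast
  have "(b, a) \<in> E ^^ n" if "(a, b) \<in> E ^^ n" for a b
    using that
  proof (induction n arbitrary: b)
    case 0
    then show ?case by simp
  next
    case (Suc n)
    then obtain c where "(a, c) \<in> E ^^ n" "(c, b) \<in> E" by auto
    then show ?case using Suc.IH assms(2) by (meson relpow_Suc_I2 symD)
  qed
  then show ?thesis using n path_dist_le by metis
qed

section \<open>Energy estimates\<close>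

lemma abs_powr_add_le:
  assumes "0 \<le> p"
  shows "\<bar>s + t :: real\<bar> powr p \<le> 2 powr p * (\<bar>s\<bar> powr p + \<bar>t\<bar> powr p)"
proof -
  define m where "m = max \<bar>s\<bar> \<bar>t\<bar>"
  have "\<bar>s + t\<bar> powr p \<le> (2 * m) powr p"
    using assms by (intro powr_mono2) (auto simp: m_def)
  also have "\<dots> = 2 powr p * m powr p" by (simp add: powr_mult m_def)
  also have "\<dots> \<le> 2 powr p * (\<bar>s\<bar> powr p + \<bar>t\<bar> powr p)"
    by (intro mult_left_mono) (auto simp: m_def max_def)
  finally show ?thesis .
qed

lemma local_energy_nonneg: "0 \<le> local_energy p E f x"
  unfolding local_energy_def by (intro sum_nonneg) auto

lemma dirichlet_sum_nonneg: "0 \<le> dirichlet_sum p E f"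
  unfolding dirichlet_sum_def by (intro infsum_nonneg) (simp add: local_energy_nonneg)

lemma sum_local_energy_le:
  assumes "f \<in> Dp p E" and "finite S"
  shows "sum (local_energy p E f) S \<le> dirichlet_sum p E f"
  using assms unfolding dirichlet_sum_def Dp_def
  by (intro finite_sum_le_infsum) (auto simp: local_energy_nonneg)

text \<open>
  The energy is the sum of \<open>\<bar>f y - f x\<bar>\<^sup>p\<close> over directed edges.  The next two lemmas
  translate between it and finite sums over sets of edges, in which form all estimates are made.
\<close>

lemma edge_sum_le_dirichlet_sum:
  assumes "bounded_degree E" and f: "f \<in> Dp p E" and S: "finite S" "S \<subseteq> E"
  shows "(\<Sum>(x, y)\<in>S. \<bar>f y - f x\<bar> powr p) \<le> dirichlet_sum p E f"
proof -
  have fin: "finite (nbrs E x)" for x using assms(1) unfolding bounded_degree_def by blast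
  have "(\<Sum>(x, y)\<in>S. \<bar>f y - f x\<bar> powr p)
      \<le> (\<Sum>(x, y)\<in>Sigma (fst ` S) (nbrs E). \<bar>f y - f x\<bar> powr p)"
  proof (rule sum_mono2)
    show "finite (Sigma (fst ` S) (nbrs E))" using S fin by auto
    show "S \<subseteq> Sigma (fst ` S) (nbrs E)" using S by (force simp: nbrs_def)
  qed auto
  also have "\<dots> = sum (local_energy p E f) (fst ` S)"
    unfolding local_energy_def using S fin by (subst sum.Sigma) auto
  also have "\<dots> \<le> dirichlet_sum p E f" using f S by (intro sum_local_energy_le) auto
  finally show ?thesis .
qed

lemma Dp_if_edge_sums_bounded:
  assumes "bounded_degree E"
    and B: "\<And>S. finite S \<Longrightarrow> S \<subseteq> E \<Longrightarrow> (\<Sum>(x, y)\<in>S. \<bar>f y - f x\<bar> powr p) \<le> B"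
  shows "f \<in> Dp p E" and "dirichlet_sum p E f \<le> B"
proof -
  have fin: "finite (nbrs E x)" for x using assms(1) unfolding bounded_degree_def by blast
  have bound: "sum (local_energy p E f) S \<le> B" if "finite S" for S
  proof -
    have "sum (local_energy p E f) S = (\<Sum>(x, y)\<in>Sigma S (nbrs E). \<bar>f y - f x\<bar> powr p)"
      unfolding local_energy_def using that fin by (subst sum.Sigma) auto
    also have "\<dots> \<le> B" using that fin by (intro B) (auto simp: nbrs_def)
    finally show ?thesis .
  qed
  show "f \<in> Dp p E"
    unfolding Dp_def mem_Collect_eq
  proof (rule nonneg_bdd_above_summable_on)
    show "bdd_above (sum (local_energy p E f) ` {F. F \<subseteq> UNIV \<and> finite F})"
      using bound by (intro bdd_aboveI[of _ B]) auto
  qed (rule local_energy_nonneg)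
  then show "dirichlet_sum p E f \<le> B"
    unfolding dirichlet_sum_def Dp_def using bound by (intro infsum_le_finite_sums) auto
qed

text \<open>
  One criterion covers sums, differences and, with the sup norms as coefficients, products.
\<close>

lemma Dp_if_increments_dominated:
  assumes "0 \<le> p" and "bounded_degree E" and f: "f \<in> Dp p E" and g: "g \<in> Dp p E"
    and dom: "\<And>x y. (x, y) \<in> E \<Longrightarrow> \<bar>h y - h x\<bar> \<le> A * \<bar>f y - f x\<bar> + B * \<bar>g y - g x\<bar>"
    and AB: "0 \<le> A" "0 \<le> B"
  shows "h \<in> Dp p E"
proof (rule Dp_if_edge_sums_bounded[OF assms(2)])
  fix S assume S: "finite S" "S \<subseteq> E"
  have "(\<Sum>(x, y)\<in>S. \<bar>h y - h x\<bar> powr p)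
      \<le> (\<Sum>(x, y)\<in>S. 2 powr p * (A powr p * \<bar>f y - f x\<bar> powr p + B powr p * \<bar>g y - g x\<bar> powr p))"
  proof (rule sum_mono, clarify)
    fix x y assume "(x, y) \<in> S"
    then have "\<bar>h y - h x\<bar> powr p \<le> \<bar>A * \<bar>f y - f x\<bar> + B * \<bar>g y - g x\<bar>\<bar> powr p"
      using S dom[of x y] assms(1) by (intro powr_mono2) auto
    also have "\<dots> \<le> 2 powr p * (\<bar>A * \<bar>f y - f x\<bar>\<bar> powr p + \<bar>B * \<bar>g y - g x\<bar>\<bar> powr p)"
      by (rule abs_powr_add_le[OF assms(1)])
    also have "\<dots> = 2 powr p * (A powr p * \<bar>f y - f x\<bar> powr p + B powr p * \<bar>g y - g x\<bar> powr p)"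
      using AB by (simp add: powr_mult)
    finally show "\<bar>h y - h x\<bar> powr p
      \<le> 2 powr p * (A powr p * \<bar>f y - f x\<bar> powr p + B powr p * \<bar>g y - g x\<bar> powr p)" .
  qed
  also have "\<dots> = 2 powr p * (A powr p * (\<Sum>(x, y)\<in>S. \<bar>f y - f x\<bar> powr p)
                            + B powr p * (\<Sum>(x, y)\<in>S. \<bar>g y - g x\<bar> powr p))"
    by (simp add: sum_distrib_left sum.distrib case_prod_unfold distrib_left)
  also have "\<dots> \<le> 2 powr p * (A powr p * dirichlet_sum p E f + B powr p * dirichlet_sum p E g)"
    using edge_sum_le_dirichlet_sum[OF assms(2) f S] edge_sum_le_dirichlet_sum[OF assms(2) g S]
    by (intro mult_left_mono add_mono) auto
  finally show "(\<Sum>(x, y)\<in>S. \<bar>h y - h x\<bar> powr p)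
    \<le> 2 powr p * (A powr p * dirichlet_sum p E f + B powr p * dirichlet_sum p E g)" .
qed

text \<open>
  Induction on the distance: the last step of the path, from \<open>\<gamma> u\<close> to \<open>\<beta> u\<close>, costs at most the local
  energy at \<open>\<gamma> u\<close>, and \<open>\<gamma>\<close> again has bounded fibres because \<open>\<alpha> u\<close> lies in a ball around \<open>\<gamma> u\<close>.
  The constant must not depend on \<open>f\<close>, since the closure of the finitely supported functions is
  treated by applying the bound to all approximation errors at once.
\<close>

lemma displaced_sum_bound:
  assumes p: "0 \<le> p" and E: "bounded_degree E" "sym E" and \<alpha>: "bounded_fibres U \<alpha>"
    and "\<And>u. u \<in> U \<Longrightarrow> (\<alpha> u, \<beta> u) \<in> (E\<^sup>=) ^^ N"
  shows "\<exists>C\<ge>0. \<forall>f\<in>Dp p E. \<forall>S. finite S \<longrightarrow> S \<subseteq> U \<longrightarrow>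
           (\<Sum>u\<in>S. \<bar>f (\<beta> u) - f (\<alpha> u)\<bar> powr p) \<le> C * dirichlet_sum p E f"
  using assms(5)
proof (induction N arbitrary: \<beta>)
  case 0
  have "(\<Sum>u\<in>S. \<bar>f (\<beta> u) - f (\<alpha> u)\<bar> powr p) = 0" if "S \<subseteq> U" for S and f :: "_ \<Rightarrow> real"
    using 0 that by (intro sum.neutral) fastforce
  then show ?case by (intro exI[of _ 0]) auto
next
  case (Suc N)
  have "\<forall>u\<in>U. \<exists>w. (\<alpha> u, w) \<in> (E\<^sup>=) ^^ N \<and> (w, \<beta> u) \<in> E\<^sup>="
    using Suc.prems by (meson relpow_Suc_E)
  then obtain \<gamma> where \<gamma>: "\<And>u. u \<in> U \<Longrightarrow> (\<alpha> u, \<gamma> u) \<in> (E\<^sup>=) ^^ N"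
      "\<And>u. u \<in> U \<Longrightarrow> (\<gamma> u, \<beta> u) \<in> E\<^sup>="
    by metis
  obtain C where C: "C \<ge> 0" "\<And>f S. f \<in> Dp p E \<Longrightarrow> finite S \<Longrightarrow> S \<subseteq> U \<Longrightarrow>
      (\<Sum>u\<in>S. \<bar>f (\<gamma> u) - f (\<alpha> u)\<bar> powr p) \<le> C * dirichlet_sum p E f"
    using Suc.IH[OF \<gamma>(1)] by blast
  obtain m where m: "\<And>x. finite (((E\<^sup>=) ^^ N) `` {x}) \<and> card (((E\<^sup>=) ^^ N) `` {x}) \<le> m"
    using finite_ball[OF E(1)] by blast
  have "bounded_fibres U \<gamma>"
    using \<gamma>(1) sym_reflcl_relpow[OF E(2), of N]
    by (intro bounded_fibres_cover[OF \<alpha>, of "\<lambda>z. ((E\<^sup>=) ^^ N) `` {z}" m] m) (auto dest: symD)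
  then obtain D where D: "\<And>z. finite {u \<in> U. \<gamma> u = z} \<and> card {u \<in> U. \<gamma> u = z} \<le> D"
    unfolding bounded_fibres_def by blast
  have "(\<Sum>u\<in>S. \<bar>f (\<beta> u) - f (\<alpha> u)\<bar> powr p) \<le> 2 powr p * (real D + C) * dirichlet_sum p E f"
    if f: "f \<in> Dp p E" and S: "finite S" "S \<subseteq> U" for f S
  proof -
    have "(\<Sum>u\<in>S. \<bar>f (\<beta> u) - f (\<alpha> u)\<bar> powr p)
        \<le> (\<Sum>u\<in>S. 2 powr p * (local_energy p E f (\<gamma> u) + \<bar>f (\<gamma> u) - f (\<alpha> u)\<bar> powr p))"
    proof (rule sum_mono)
      fix u assume "u \<in> S"
      then have "(\<gamma> u, \<beta> u) \<in> E\<^sup>=" using S \<gamma> by blast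
      then consider "\<gamma> u = \<beta> u" | "\<beta> u \<in> nbrs E (\<gamma> u)" by (auto simp: nbrs_def)
      then have step: "\<bar>f (\<beta> u) - f (\<gamma> u)\<bar> powr p \<le> local_energy p E f (\<gamma> u)"
      proof cases
        case 1
        then show ?thesis by (simp add: local_energy_nonneg)
      next
        case 2
        then show ?thesis
          using E(1) unfolding local_energy_def bounded_degree_def
          by (intro member_le_sum[of "\<beta> u" "nbrs E (\<gamma> u)" "\<lambda>y. \<bar>f y - f (\<gamma> u)\<bar> powr p"]) auto
      qed
      have "\<bar>f (\<beta> u) - f (\<alpha> u)\<bar> powr p
          \<le> 2 powr p * (\<bar>f (\<beta> u) - f (\<gamma> u)\<bar> powr p + \<bar>f (\<gamma> u) - f (\<alpha> u)\<bar> powr p)"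
        using abs_powr_add_le[OF p, of "f (\<beta> u) - f (\<gamma> u)" "f (\<gamma> u) - f (\<alpha> u)"] by simp
      also have "\<dots> \<le> 2 powr p * (local_energy p E f (\<gamma> u) + \<bar>f (\<gamma> u) - f (\<alpha> u)\<bar> powr p)"
        using step by (intro mult_left_mono add_right_mono) auto
      finally show "\<bar>f (\<beta> u) - f (\<alpha> u)\<bar> powr p
          \<le> 2 powr p * (local_energy p E f (\<gamma> u) + \<bar>f (\<gamma> u) - f (\<alpha> u)\<bar> powr p)" .
    qed
    also have "\<dots> = 2 powr p * ((\<Sum>u\<in>S. local_energy p E f (\<gamma> u))
                             + (\<Sum>u\<in>S. \<bar>f (\<gamma> u) - f (\<alpha> u)\<bar> powr p))"
      by (simp add: sum.distrib flip: sum_distrib_left)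
    also have "\<dots> \<le> 2 powr p * (real D * dirichlet_sum p E f + C * dirichlet_sum p E f)"
      using sum_comp_le_card_fibre_mult[OF D local_energy_nonneg sum_local_energy_le[OF f] S]
        C(2)[OF f S]
      by (intro mult_left_mono add_mono) auto
    also have "\<dots> = 2 powr p * (real D + C) * dirichlet_sum p E f" by (simp add: algebra_simps)
    finally show ?thesis .
  qed
  moreover have "2 powr p * (real D + C) \<ge> 0" using C(1) by simp
  ultimately show ?case by blast
qed

section \<open>Functions with summable \<open>p\<close>-th powers\<close>

lemma edge_fibres_le_degree:
  assumes k: "\<And>x. finite (nbrs E x) \<and> card (nbrs E x) \<le> k" and "sym E"
  shows "finite {e \<in> E. fst e = z} \<and> card {e \<in> E. fst e = z} \<le> k"
    and "finite {e \<in> E. snd e = z} \<and> card {e \<in> E. snd e = z} \<le> k"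
proof -
  have 1: "{e \<in> E. fst e = z} = Pair z ` nbrs E z" by (auto simp: nbrs_def)
  have 2: "{e \<in> E. snd e = z} = (\<lambda>y. (y, z)) ` nbrs E z"
    using assms(2) by (auto simp: nbrs_def dest: symD)
  have c: "card (f ` nbrs E z) \<le> k" for f :: "_ \<Rightarrow> 'a \<times> 'a"
    using k[of z] card_image_le[of "nbrs E z" f] by linarith
  show "finite {e \<in> E. fst e = z} \<and> card {e \<in> E. fst e = z} \<le> k"
    "finite {e \<in> E. snd e = z} \<and> card {e \<in> E. snd e = z} \<le> k"
    unfolding 1 2 using k c by blast+
qed

text \<open>
  Each vertex is the source of at most \<open>k\<close> directed edges and, by symmetry, the target of at most
  \<open>k\<close>; this is the factor \<open>2 k\<close>.
\<close>

lemma lp_energy_bound: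
  assumes p: "0 \<le> p" and k: "\<And>x. finite (nbrs E x) \<and> card (nbrs E x) \<le> k" and "sym E"
    and B: "\<And>S. finite S \<Longrightarrow> (\<Sum>x\<in>S. \<bar>g x\<bar> powr p) \<le> B"
  shows "g \<in> Dp p E" and "dirichlet_sum p E g \<le> 2 powr p * (2 * real k) * B"
proof -
  have E: "bounded_degree E" using k unfolding bounded_degree_def by blast
  have bound: "(\<Sum>(x, y)\<in>S. \<bar>g y - g x\<bar> powr p) \<le> 2 powr p * (2 * real k) * B"
    if S: "finite S" "S \<subseteq> E" for S
  proof -
    have "(\<Sum>(x, y)\<in>S. \<bar>g y - g x\<bar> powr p)
        \<le> (\<Sum>u\<in>S. 2 powr p * (\<bar>g (snd u)\<bar> powr p + \<bar>g (fst u)\<bar> powr p))"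
      unfolding case_prod_unfold
    proof (rule sum_mono)
      fix u
      show "\<bar>g (snd u) - g (fst u)\<bar> powr p
          \<le> 2 powr p * (\<bar>g (snd u)\<bar> powr p + \<bar>g (fst u)\<bar> powr p)"
        using abs_powr_add_le[OF p, of "g (snd u)" "- g (fst u)"] by simp
    qed
    also have "\<dots> = 2 powr p * ((\<Sum>u\<in>S. \<bar>g (snd u)\<bar> powr p) + (\<Sum>u\<in>S. \<bar>g (fst u)\<bar> powr p))"
      by (simp add: sum.distrib flip: sum_distrib_left)
    also have "\<dots> \<le> 2 powr p * (real k * B + real k * B)"
      using edge_fibres_le_degree[OF k \<open>sym E\<close>] B S
      by (intro mult_left_mono add_mono sum_comp_le_card_fibre_mult[where h = "\<lambda>x. \<bar>g x\<bar> powr p"]) auto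
    finally show ?thesis by (simp add: algebra_simps)
  qed
  show "g \<in> Dp p E" "dirichlet_sum p E g \<le> 2 powr p * (2 * real k) * B"
    by (rule Dp_if_edge_sums_bounded[OF E bound]; assumption)+
qed

text \<open>
  Cutting \<open>g\<close> off outside a large finite set leaves a remainder of small \<open>\<ell>\<^sup>p\<close> norm, and that norm
  dominates both the energy and the value at the base vertex.
\<close>

lemma lp_subset_Dp_closure_finsupp:
  assumes p: "0 < p" and E: "bounded_degree E" "sym E"
    and B: "\<And>S. finite S \<Longrightarrow> (\<Sum>x\<in>S. \<bar>g x\<bar> powr p) \<le> B"
  shows "g \<in> Dp_closure_finsupp p E v0"
proof -
  have p': "0 \<le> p" using p by simp
  obtain k where k: "\<And>x. finite (nbrs E x) \<and> card (nbrs E x) \<le> k"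
    using E(1) unfolding bounded_degree_def by blast
  define C where "C = 2 powr p * (2 * real k)"
  have C: "C \<ge> 0" unfolding C_def by simp
  let ?h = "\<lambda>x. \<bar>g x\<bar> powr p"
  have summ: "?h summable_on UNIV"
  proof (rule nonneg_bdd_above_summable_on)
    show "bdd_above (sum ?h ` {F. F \<subseteq> UNIV \<and> finite F})"
      using B by (intro bdd_aboveI[of _ B]) auto
  qed auto
  have "\<exists>g'\<in>finitely_supported. Dp_norm p E v0 (\<lambda>x. g x - g' x) < \<epsilon>" if "\<epsilon> > 0" for \<epsilon>
  proof -
    (* The energy of the remainder will be at most C * \<delta>, its value at v0 contributes \<delta>. *)
    define \<delta> where "\<delta> = (\<epsilon> / 2) powr p / (C + 1)"
    have \<delta>: "\<delta> > 0" using \<open>\<epsilon> > 0\<close> C unfolding \<delta>_def by simp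
    obtain F where F: "finite F" "dist (sum ?h F) (infsum ?h UNIV) \<le> \<delta>"
      using infsum_finite_approximation[OF summ \<delta>] by blast
    define g' where "g' = (\<lambda>x. if x \<in> F then g x else 0)"
    define r where "r = (\<lambda>x. g x - g' x)"
    have fs: "g' \<in> finitely_supported"
      unfolding finitely_supported_def g'_def using F(1) by (auto intro: finite_subset)
    have tail: "(\<Sum>x\<in>S. \<bar>r x\<bar> powr p) \<le> \<delta>" if "finite S" for S
    proof -
      have "(\<Sum>x\<in>S. \<bar>r x\<bar> powr p) = sum ?h (S - F)"
        unfolding r_def g'_def using that by (intro sum.mono_neutral_cong_right) auto
      also have "\<dots> = sum ?h (S \<union> F) - sum ?h F"
        using that F(1) sum_diff[of "S \<union> F" F ?h] by (simp add: Un_Diff)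
      also have "sum ?h (S \<union> F) \<le> infsum ?h UNIV"
        using that F(1) by (intro finite_sum_le_infsum[OF summ]) auto
      finally show ?thesis using F(2) unfolding dist_real_def by linarith
    qed
    have "dirichlet_sum p E r \<le> C * \<delta>"
      unfolding C_def by (rule lp_energy_bound(2)[OF p' k E(2) tail])
    moreover have "\<bar>r v0\<bar> powr p \<le> \<delta>" using tail[of "{v0}"] by simp
    ultimately have "dirichlet_sum p E r + \<bar>r v0\<bar> powr p \<le> C * \<delta> + \<delta>" by linarith
    also have "\<dots> = (C + 1) * \<delta>" by (simp add: algebra_simps)
    also have "\<dots> = (\<epsilon> / 2) powr p" unfolding \<delta>_def using C by simp
    finally have "Dp_norm p E v0 r \<le> ((\<epsilon> / 2) powr p) powr (1 / p)"
      unfolding Dp_norm_def using p by (intro powr_mono2) (auto simp: dirichlet_sum_nonneg)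
    also have "\<dots> < \<epsilon>" using \<open>\<epsilon> > 0\<close> p by (simp add: powr_powr)
    finally show ?thesis using fs unfolding r_def by blast
  qed
  moreover have "g \<in> Dp p E" by (rule lp_energy_bound(1)[OF p' k E(2) B])
  ultimately show ?thesis unfolding Dp_closure_finsupp_def by blast
qed

lemma finitely_supported_B_closure:
  assumes p: "0 < p" and E: "bounded_degree E" "sym E" and g: "g \<in> finitely_supported"
  shows "g \<in> B_closure_finsupp p E v0"
proof -
  let ?T = "{x. g x \<noteq> 0}"
  have fin: "finite ?T" using g unfolding finitely_supported_def by simp
  have "(\<Sum>x\<in>S. \<bar>g x\<bar> powr p) \<le> (\<Sum>x\<in>?T. \<bar>g x\<bar> powr p)" if "finite S" for S
  proof -
    have "(\<Sum>x\<in>S. \<bar>g x\<bar> powr p) = (\<Sum>x\<in>S \<inter> ?T. \<bar>g x\<bar> powr p)"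
      using that by (intro sum.mono_neutral_cong_right) auto
    also have "\<dots> \<le> (\<Sum>x\<in>?T. \<bar>g x\<bar> powr p)" using fin by (intro sum_mono2) auto
    finally show ?thesis .
  qed
  then have "g \<in> Dp_closure_finsupp p E v0" by (rule lp_subset_Dp_closure_finsupp[OF p E])
  moreover have "range g \<subseteq> insert 0 (g ` ?T)" by auto
  then have "bounded (range g)" using fin by (meson finite_imp_bounded finite_imageI finite_insert bounded_subset)
  ultimately show ?thesis unfolding B_closure_finsupp_def bounded_functions_def by blast
qed

section \<open>Bounded Dirichlet functions and their characters\<close>

lemma BDp_const: "(\<lambda>x. c) \<in> BDp p E"
  unfolding BDp_def Dp_def bounded_functions_def local_energy_def by simp

lemma BDp_bound:
  assumes "f \<in> BDp p E"
  obtains A where "A \<ge> 0" "\<And>x. \<bar>f x\<bar> \<le> A"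
proof -
  have "bounded (range f)" using assms unfolding BDp_def bounded_functions_def by simp
  then obtain A where "\<And>x. norm (f x) \<le> A" unfolding bounded_iff by auto
  then show ?thesis using that[of "max A 0"] by (simp add: le_max_iff_disj)
qed

lemma BDpI:
  assumes "f \<in> Dp p E" and "\<And>x. \<bar>f x\<bar> \<le> A"
  shows "f \<in> BDp p E"
  using assms unfolding BDp_def bounded_functions_def bounded_iff by auto

lemma
  assumes p: "0 \<le> p" and E: "bounded_degree E" and f: "f \<in> BDp p E" and g: "g \<in> BDp p E"
  shows BDp_add: "(\<lambda>x. f x + g x) \<in> BDp p E"
    and BDp_mult: "(\<lambda>x. f x * g x) \<in> BDp p E"
proof -
  obtain A where A: "A \<ge> 0" "\<And>x. \<bar>f x\<bar> \<le> A" using BDp_bound[OF f] by blast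
  obtain B where B: "B \<ge> 0" "\<And>x. \<bar>g x\<bar> \<le> B" using BDp_bound[OF g] by blast
  have D: "f \<in> Dp p E" "g \<in> Dp p E" using f g unfolding BDp_def by auto
  show "(\<lambda>x. f x + g x) \<in> BDp p E"
  proof (rule BDpI)
    show "(\<lambda>x. f x + g x) \<in> Dp p E"
      by (rule Dp_if_increments_dominated[OF p E D, of _ 1 1]) auto
    show "\<bar>f x + g x\<bar> \<le> A + B" for x using A(2)[of x] B(2)[of x] by linarith
  qed
  show "(\<lambda>x. f x * g x) \<in> BDp p E"
  proof (rule BDpI)
    show "\<bar>f x * g x\<bar> \<le> A * B" for x
      unfolding abs_mult using A B by (intro mult_mono) auto
    show "(\<lambda>x. f x * g x) \<in> Dp p E"
    proof (rule Dp_if_increments_dominated[OF p E D _ B(1) A(1)])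
      fix x y
      (* Leibniz rule for increments *)
      have "f y * g y - f x * g x = (f y - f x) * g y + f x * (g y - g x)"
        by (simp add: algebra_simps)
      then have "\<bar>f y * g y - f x * g x\<bar> \<le> \<bar>f y - f x\<bar> * \<bar>g y\<bar> + \<bar>f x\<bar> * \<bar>g y - g x\<bar>"
        by (metis abs_mult abs_triangle_ineq)
      also have "\<dots> \<le> B * \<bar>f y - f x\<bar> + A * \<bar>g y - g x\<bar>"
        using A(2)[of x] B(2)[of y] by (intro add_mono) (simp_all add: mult.commute mult_left_mono mult_right_mono)
      finally show "\<bar>f y * g y - f x * g x\<bar> \<le> B * \<bar>f y - f x\<bar> + A * \<bar>g y - g x\<bar>" .
    qed
  qed
qed

lemma Sp_add:
  assumes "\<tau> \<in> Sp p E" and "f \<in> BDp p E" and "g \<in> BDp p E"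
  shows "\<tau> (\<lambda>x. f x + g x) = \<tau> f + \<tau> g"
  using assms unfolding Sp_def by simp

lemma Sp_mult:
  assumes "\<tau> \<in> Sp p E" and "f \<in> BDp p E" and "g \<in> BDp p E"
  shows "\<tau> (\<lambda>x. f x * g x) = \<tau> f * \<tau> g"
  using assms unfolding Sp_def by simp

lemma Sp_one:
  assumes "\<tau> \<in> Sp p E"
  shows "\<tau> (\<lambda>x. 1) = 1"
proof -
  obtain f where f: "f \<in> BDp p E" "\<tau> f \<noteq> 0" using assms unfolding Sp_def by auto
  have "\<tau> (\<lambda>x. 1 * f x) = \<tau> (\<lambda>x. 1) * \<tau> f"
    by (rule Sp_mult[OF assms BDp_const f(1)])
  then show ?thesis using f(2) by simp
qed

lemma B_closure_finsupp_in_BDp: "f \<in> B_closure_finsupp p E v0 \<Longrightarrow> f \<in> BDp p E"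
  unfolding B_closure_finsupp_def Dp_closure_finsupp_def BDp_def by blast

section \<open>Coarse maps and pullback\<close>

text \<open>
  These two properties of a rough isometry are what pulling back functions requires: bounded
  stretching of edges controls the energy, and bounded fibres control multiplicities and keep
  supports finite.
\<close>

definition coarse_map :: "('v \<times> 'v) set \<Rightarrow> ('w \<times> 'w) set \<Rightarrow> ('v \<Rightarrow> 'w) \<Rightarrow> bool" where
  "coarse_map E F \<phi> \<longleftrightarrow>
     bounded_fibres UNIV \<phi> \<and> (\<exists>N. \<forall>x y. (x, y) \<in> E \<longrightarrow> (\<phi> x, \<phi> y) \<in> (F\<^sup>=) ^^ N)"

lemma coarse_map_energy_bound:
  assumes p: "0 \<le> p" and E: "bounded_degree E" "sym E" and F: "bounded_degree F" "sym F"
    and \<phi>: "coarse_map E F \<phi>"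
  shows "\<exists>C\<ge>0. \<forall>f\<in>Dp p F. (\<lambda>x. f (\<phi> x)) \<in> Dp p E \<and>
           dirichlet_sum p E (\<lambda>x. f (\<phi> x)) \<le> C * dirichlet_sum p F f"
proof -
  obtain N where N: "\<And>x y. (x, y) \<in> E \<Longrightarrow> (\<phi> x, \<phi> y) \<in> (F\<^sup>=) ^^ N"
    using \<phi> unfolding coarse_map_def by blast
  obtain k where k: "\<And>x. finite (nbrs E x) \<and> card (nbrs E x) \<le> k"
    using E(1) unfolding bounded_degree_def by blast
  have "bounded_fibres E fst"
    unfolding bounded_fibres_def using edge_fibres_le_degree(1)[OF k E(2)] by blast
  then have fib: "bounded_fibres E (\<lambda>e. \<phi> (fst e))"
    using \<phi> unfolding coarse_map_def by (blast intro: bounded_fibres_comp[of E fst \<phi>])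
  have "\<exists>C\<ge>0. \<forall>f\<in>Dp p F. \<forall>S. finite S \<longrightarrow> S \<subseteq> E \<longrightarrow>
           (\<Sum>e\<in>S. \<bar>f (\<phi> (snd e)) - f (\<phi> (fst e))\<bar> powr p) \<le> C * dirichlet_sum p F f"
    using N by (intro displaced_sum_bound[OF p F fib, of _ N]) auto
  then obtain C where C: "C \<ge> 0" "\<And>f S. f \<in> Dp p F \<Longrightarrow> finite S \<Longrightarrow> S \<subseteq> E \<Longrightarrow>
           (\<Sum>e\<in>S. \<bar>f (\<phi> (snd e)) - f (\<phi> (fst e))\<bar> powr p) \<le> C * dirichlet_sum p F f"
    by blast
  have "(\<lambda>x. f (\<phi> x)) \<in> Dp p E \<and> dirichlet_sum p E (\<lambda>x. f (\<phi> x)) \<le> C * dirichlet_sum p F f"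
    if "f \<in> Dp p F" for f
  proof -
    have "(\<Sum>(x, y)\<in>S. \<bar>f (\<phi> y) - f (\<phi> x)\<bar> powr p) \<le> C * dirichlet_sum p F f"
      if "finite S" "S \<subseteq> E" for S
      using C(2)[OF \<open>f \<in> Dp p F\<close> that] by (simp add: case_prod_unfold)
    from Dp_if_edge_sums_bounded[OF E(1) this] show ?thesis by blast
  qed
  with C(1) show ?thesis by blast
qed

lemma BDp_pullback:
  assumes p: "0 \<le> p" and E: "bounded_degree E" "sym E" and F: "bounded_degree F" "sym F"
    and \<phi>: "coarse_map E F \<phi>" and f: "f \<in> BDp p F"
  shows "(\<lambda>x. f (\<phi> x)) \<in> BDp p E"
proof -
  obtain A where A: "\<And>x. \<bar>f x\<bar> \<le> A" using BDp_bound[OF f] by blast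
  have "(\<lambda>x. f (\<phi> x)) \<in> Dp p E"
    using coarse_map_energy_bound[OF p E F \<phi>] f unfolding BDp_def by blast
  then show ?thesis using A by (rule BDpI)
qed

text \<open>
  Pullback sends finitely supported functions to finitely supported ones, so it remains to see
  that it is bounded for the norms of \<open>D\<^sub>p\<close>.  These norms involve unrelated base vertices \<open>v0\<close> and \<open>w0\<close>;
  the values at \<open>\<phi> v0\<close> and \<open>w0\<close> are compared along a path, which exists by connectedness.
\<close>

lemma B_closure_pullback:
  assumes p: "0 < p" and E: "bounded_degree E" "sym E"
    and F: "bounded_degree F" "sym F" "connected_graph F"
    and \<phi>: "coarse_map E F \<phi>" and f: "f \<in> B_closure_finsupp p F w0"
  shows "(\<lambda>x. f (\<phi> x)) \<in> B_closure_finsupp p E v0"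
proof -
  have p': "0 \<le> p" using p by simp
  obtain C where C: "C \<ge> 0" "\<And>f. f \<in> Dp p F \<Longrightarrow> (\<lambda>x. f (\<phi> x)) \<in> Dp p E \<and>
           dirichlet_sum p E (\<lambda>x. f (\<phi> x)) \<le> C * dirichlet_sum p F f"
    using coarse_map_energy_bound[OF p' E F(1,2) \<phi>] by blast
  obtain D where D: "D \<ge> 0" "\<And>f. f \<in> Dp p F \<Longrightarrow>
      \<bar>f (\<phi> v0) - f w0\<bar> powr p \<le> D * dirichlet_sum p F f"
  proof -
    (* A one-element index set turns the estimate on sums into one for a single pair of vertices. *)
    have "bounded_fibres {()} (\<lambda>_. w0)"
      unfolding bounded_fibres_def by (intro exI[of _ 1]) (auto intro: order_trans[OF card_mono])
    moreover have "(w0, \<phi> v0) \<in> (F\<^sup>=) ^^ nat \<lceil>path_dist F w0 (\<phi> v0)\<rceil>"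
      by (rule path_dist_le_imp_reflcl_relpow[OF F(3)]) simp
    ultimately have "\<exists>C\<ge>0. \<forall>f\<in>Dp p F. \<forall>S. finite S \<longrightarrow> S \<subseteq> {()} \<longrightarrow>
           (\<Sum>u\<in>S. \<bar>f (\<phi> v0) - f w0\<bar> powr p) \<le> C * dirichlet_sum p F f"
      by (intro displaced_sum_bound[OF p' F(1,2)]) auto
    then obtain C where C: "C\<ge>0" "\<And>f S. f\<in>Dp p F \<Longrightarrow> finite S \<Longrightarrow> S \<subseteq> {()} \<Longrightarrow>
           (\<Sum>u\<in>S. \<bar>f (\<phi> v0) - f w0\<bar> powr p) \<le> C * dirichlet_sum p F f" by blast
    show ?thesis
      using C(2)[of _ "{()}"] by (intro that[OF C(1)]) simp
  qed
  (* The summand 1 makes K positive, so that one can divide by it. *)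
  define K where "K = C + 2 powr p * (D + 1) + 1"
  have K: "K > 0" unfolding K_def using C(1) D(1) by (simp add: add_nonneg_pos)
  have norm: "Dp_norm p E v0 (\<lambda>x. h (\<phi> x)) \<le> K powr (1 / p) * Dp_norm p F w0 h"
    if h: "h \<in> Dp p F" for h
  proof -
    let ?I = "dirichlet_sum p F h" and ?a = "\<bar>h w0\<bar> powr p"
    have I: "?I \<ge> 0" "?a \<ge> 0" by (auto simp: dirichlet_sum_nonneg)
    have "\<bar>h (\<phi> v0)\<bar> powr p \<le> 2 powr p * (\<bar>h (\<phi> v0) - h w0\<bar> powr p + ?a)"
      using abs_powr_add_le[OF p', of "h (\<phi> v0) - h w0" "h w0"] by simp
    also have "\<dots> \<le> 2 powr p * (D * ?I + ?a)"
      using D(2)[OF h] by (intro mult_left_mono) auto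
    also have "\<dots> \<le> 2 powr p * ((D + 1) * (?I + ?a))"
      using I D(1) by (intro mult_left_mono) (auto simp: algebra_simps)
    finally have 1: "\<bar>h (\<phi> v0)\<bar> powr p \<le> 2 powr p * (D + 1) * (?I + ?a)" by (simp add: mult.assoc)
    have 2: "dirichlet_sum p E (\<lambda>x. h (\<phi> x)) \<le> C * (?I + ?a)"
      using C(2)[OF h] C(1) I by (smt (verit) mult_left_mono)
    have "dirichlet_sum p E (\<lambda>x. h (\<phi> x)) + \<bar>h (\<phi> v0)\<bar> powr p \<le> K * (?I + ?a)"
      using add_mono[OF add_mono[OF 2 1] add_nonneg_nonneg[OF I]]
      unfolding K_def distrib_right by simp
    then have "Dp_norm p E v0 (\<lambda>x. h (\<phi> x)) \<le> (K * (?I + ?a)) powr (1 / p)"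
      unfolding Dp_norm_def using p by (intro powr_mono2) (auto simp: dirichlet_sum_nonneg)
    also have "\<dots> = K powr (1 / p) * Dp_norm p F w0 h"
      unfolding Dp_norm_def using K I by (simp add: powr_mult)
    finally show ?thesis .
  qed
  have fD: "f \<in> Dp p F" "f \<in> BDp p F"
    and approx: "\<And>\<epsilon>. \<epsilon> > 0 \<Longrightarrow> \<exists>g\<in>finitely_supported. Dp_norm p F w0 (\<lambda>x. f x - g x) < \<epsilon>"
    using f unfolding B_closure_finsupp_def Dp_closure_finsupp_def BDp_def by auto
  have "\<exists>g\<in>finitely_supported. Dp_norm p E v0 (\<lambda>x. f (\<phi> x) - g x) < \<epsilon>" if "\<epsilon> > 0" for \<epsilon>
  proof -
    have "\<epsilon> / K powr (1 / p) > 0" using that K by simp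
    then obtain g where g: "g \<in> finitely_supported"
        "Dp_norm p F w0 (\<lambda>x. f x - g x) < \<epsilon> / K powr (1 / p)"
      using approx by blast
    have gD: "g \<in> Dp p F"
      using finitely_supported_B_closure[OF p F(1,2) g(1)]
      unfolding B_closure_finsupp_def Dp_closure_finsupp_def by blast
    have "(\<lambda>x. f x - g x) \<in> Dp p F"
      by (rule Dp_if_increments_dominated[OF p' F(1) fD(1) gD, of _ 1 1]) auto
    from norm[OF this] have "Dp_norm p E v0 (\<lambda>x. f (\<phi> x) - g (\<phi> x))
        \<le> K powr (1 / p) * Dp_norm p F w0 (\<lambda>x. f x - g x)" .
    also have "\<dots> < \<epsilon>" using g(2) K by (simp add: field_simps)
    finally have lt: "Dp_norm p E v0 (\<lambda>x. f (\<phi> x) - g (\<phi> x)) < \<epsilon>" .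
    have "{x. g (\<phi> x) \<noteq> 0} = (\<Union>z\<in>{z. g z \<noteq> 0}. {x \<in> UNIV. \<phi> x = z})" by auto
    moreover have "finite \<dots>"
      using g(1) \<phi> unfolding finitely_supported_def coarse_map_def bounded_fibres_def by blast
    ultimately have "(\<lambda>x. g (\<phi> x)) \<in> finitely_supported" unfolding finitely_supported_def by simp
    with lt show ?thesis by (intro bexI[of _ "\<lambda>x. g (\<phi> x)"])
  qed
  moreover have "(\<lambda>x. f (\<phi> x)) \<in> BDp p E" by (rule BDp_pullback[OF p' E F(1,2) \<phi> fD(2)])
  ultimately show ?thesis
    unfolding B_closure_finsupp_def Dp_closure_finsupp_def BDp_def by blast
qed

text \<open>
  Moving every vertex by a bounded amount changes a Dirichlet function only by an \<open>\<ell>\<^sup>p\<close> function.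
\<close>

lemma diff_displaced_B_closure:
  assumes p: "0 < p" and E: "bounded_degree E" "sym E"
    and \<theta>: "\<And>x. (x, \<theta> x) \<in> (E\<^sup>=) ^^ N" and f: "f \<in> BDp p E"
  shows "(\<lambda>x. f (\<theta> x) - f x) \<in> B_closure_finsupp p E v0"
proof -
  have "\<exists>C\<ge>0. \<forall>f\<in>Dp p E. \<forall>S. finite S \<longrightarrow> S \<subseteq> UNIV \<longrightarrow>
           (\<Sum>x\<in>S. \<bar>f (\<theta> x) - f x\<bar> powr p) \<le> C * dirichlet_sum p E f"
    using p \<theta> by (intro displaced_sum_bound[OF _ E bounded_fibres_id, of _ _ N]) auto
  then obtain C where "\<And>S. finite S \<Longrightarrow> (\<Sum>x\<in>S. \<bar>f (\<theta> x) - f x\<bar> powr p) \<le> C * dirichlet_sum p E f"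
    using f unfolding BDp_def by blast
  then have "(\<lambda>x. f (\<theta> x) - f x) \<in> Dp_closure_finsupp p E v0"
    by (rule lp_subset_Dp_closure_finsupp[OF p E])
  moreover obtain A where A: "\<And>x. \<bar>f x\<bar> \<le> A" using BDp_bound[OF f] by blast
  have "\<bar>f (\<theta> x) - f x\<bar> \<le> A + A" for x using A[of x] A[of "\<theta> x"] by linarith
  then have "(\<lambda>x. f (\<theta> x) - f x) \<in> bounded_functions"
    unfolding bounded_functions_def bounded_iff by auto
  ultimately show ?thesis unfolding B_closure_finsupp_def by blast
qed

section \<open>The induced map on harmonic boundaries\<close>

text \<open>
  On the image of the vertices this extends \<open>\<phi>\<close>: evaluation at \<open>x\<close> is sent to evaluation at \<open>\<phi> x\<close>.
  The restriction to \<open>BD\<^sub>p\<close> makes the result extensional, as elements of the spectrum are.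
\<close>

definition pushforward :: "real \<Rightarrow> ('w \<times> 'w) set \<Rightarrow> ('v \<Rightarrow> 'w) \<Rightarrow>
    (('v \<Rightarrow> real) \<Rightarrow> complex) \<Rightarrow> (('w \<Rightarrow> real) \<Rightarrow> complex)" where
  "pushforward p F \<phi> \<tau> = (\<lambda>f\<in>BDp p F. \<tau> (\<lambda>x. f (\<phi> x)))"

lemma Sp_pushforward:
  assumes p: "0 \<le> p" and E: "bounded_degree E" "sym E" and F: "bounded_degree F" "sym F"
    and \<phi>: "coarse_map E F \<phi>" and \<tau>: "\<tau> \<in> Sp p E"
  shows "pushforward p F \<phi> \<tau> \<in> Sp p F"
proof -
  note pb = BDp_pullback[OF p E F \<phi>]
  have scale: "(\<lambda>x. c * f x) \<in> BDp p F" if "f \<in> BDp p F" for c f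
    using BDp_mult[OF p F(1) BDp_const[of c] that] .
  have "pushforward p F \<phi> \<tau> (\<lambda>x. 1) \<noteq> 0"
    unfolding pushforward_def using Sp_one[OF \<tau>] BDp_const[of 1 p F] by simp
  moreover have "\<forall>f\<in>BDp p F. \<forall>g\<in>BDp p F. pushforward p F \<phi> \<tau> (\<lambda>x. f x + g x) = pushforward p F \<phi> \<tau> f + pushforward p F \<phi> \<tau> g"
    using \<tau> pb unfolding pushforward_def Sp_def by (auto simp: BDp_add[OF p F(1)])
  moreover have "\<forall>f\<in>BDp p F. \<forall>g\<in>BDp p F. pushforward p F \<phi> \<tau> (\<lambda>x. f x * g x) = pushforward p F \<phi> \<tau> f * pushforward p F \<phi> \<tau> g"
    using \<tau> pb unfolding pushforward_def Sp_def by (auto simp: BDp_mult[OF p F(1)])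
  moreover have "\<forall>c. \<forall>f\<in>BDp p F. pushforward p F \<phi> \<tau> (\<lambda>x. c * f x) = complex_of_real c * pushforward p F \<phi> \<tau> f"
    using \<tau> pb unfolding pushforward_def Sp_def by (auto simp: scale)
  moreover have "pushforward p F \<phi> \<tau> \<in> extensional (BDp p F)" unfolding pushforward_def by simp
  ultimately show ?thesis
    unfolding Sp_def using BDp_const[of 1 p F] by blast
qed

text \<open>
  Evaluation at \<open>x\<close> takes the value one on the indicator function of \<open>x\<close>, which is finitely
  supported.  Hence a character that vanishes on the closure lies in the Royden boundary.
\<close>

lemma harmonic_boundary_iff:
  assumes "0 < p" and "bounded_degree E" "sym E"
  shows "\<tau> \<in> harmonic_boundary p E v0 \<longleftrightarrow>
           \<tau> \<in> Sp p E \<and> (\<forall>f\<in>B_closure_finsupp p E v0. \<tau> f = 0)"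
proof -
  have "\<tau> \<noteq> point_eval p E x" if *: "\<forall>f\<in>B_closure_finsupp p E v0. \<tau> f = 0" for x
  proof
    assume eq: "\<tau> = point_eval p E x"
    let ?d = "\<lambda>y. if y = x then 1 else 0 :: real"
    have d: "?d \<in> B_closure_finsupp p E v0"
      by (rule finitely_supported_B_closure[OF assms]) (simp add: finitely_supported_def)
    then have "?d \<in> BDp p E" by (rule B_closure_finsupp_in_BDp)
    then have "\<tau> ?d = 1" unfolding eq point_eval_def by simp
    with bspec[OF * d] show False by simp
  qed
  then show ?thesis unfolding harmonic_boundary_def royden_boundary_def by blast
qed

lemma harmonic_boundary_pushforward:
  assumes p: "0 < p" and E: "bounded_degree E" "sym E"
    and F: "bounded_degree F" "sym F" "connected_graph F"
    and \<phi>: "coarse_map E F \<phi>" and \<tau>: "\<tau> \<in> harmonic_boundary p E v0"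
  shows "pushforward p F \<phi> \<tau> \<in> harmonic_boundary p F w0"
proof -
  have \<tau>': "\<tau> \<in> Sp p E" "\<forall>f\<in>B_closure_finsupp p E v0. \<tau> f = 0"
    using \<tau> unfolding harmonic_boundary_iff[OF p E] by auto
  have "pushforward p F \<phi> \<tau> f = 0" if "f \<in> B_closure_finsupp p F w0" for f
  proof -
    have "f \<in> BDp p F" using that by (rule B_closure_finsupp_in_BDp)
    moreover have "(\<lambda>x. f (\<phi> x)) \<in> B_closure_finsupp p E v0"
      by (rule B_closure_pullback[OF p E F \<phi> that])
    ultimately show ?thesis using \<tau>'(2) unfolding pushforward_def by simp
  qed
  moreover have "pushforward p F \<phi> \<tau> \<in> Sp p F"
    using p by (intro Sp_pushforward[OF _ E F(1,2) \<phi> \<tau>'(1)]) simp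
  ultimately show ?thesis unfolding harmonic_boundary_iff[OF p F(1,2)] by blast
qed

lemma topspace_harmonic_boundary_space:
  "topspace (harmonic_boundary_space p E v0) = harmonic_boundary p E v0"
proof -
  have "harmonic_boundary p E v0 \<subseteq> Sp p E"
    unfolding harmonic_boundary_def royden_boundary_def by blast
  moreover have "Sp p E \<subseteq> extensional (BDp p E)"
    unfolding Sp_def by (rule Collect_subset)
  moreover have "topspace (product_topology (\<lambda>_. euclidean :: complex topology) (BDp p E))
      = extensional (BDp p E)"
    by (simp add: PiE_def)
  ultimately show ?thesis
    unfolding harmonic_boundary_space_def Sp_topology_def topspace_subtopology by blast
qed

text \<open>
  The topology is that of pointwise convergence, and the coordinate of the image at \<open>f\<close> is the
  coordinate of \<open>\<tau>\<close> at \<open>f \<circ> \<phi>\<close>.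
\<close>

lemma continuous_map_pushforward:
  assumes p: "0 < p" and E: "bounded_degree E" "sym E"
    and F: "bounded_degree F" "sym F" "connected_graph F"
    and \<phi>: "coarse_map E F \<phi>"
  shows "continuous_map (harmonic_boundary_space p E v0) (harmonic_boundary_space p F w0) (pushforward p F \<phi>)"
proof -
  have img: "pushforward p F \<phi> \<tau> \<in> harmonic_boundary p F w0" if "\<tau> \<in> harmonic_boundary p E v0" for \<tau>
    by (rule harmonic_boundary_pushforward[OF p E F \<phi> that])
  have sub: "harmonic_boundary p F w0 \<subseteq> Sp p F"
    unfolding harmonic_boundary_def royden_boundary_def by blast
  have "continuous_map (harmonic_boundary_space p E v0)
          (product_topology (\<lambda>_. euclidean) (BDp p F)) (pushforward p F \<phi>)"
    unfolding continuous_map_componentwise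
  proof (intro conjI ballI)
    show "pushforward p F \<phi> ` topspace (harmonic_boundary_space p E v0) \<subseteq> extensional (BDp p F)"
      unfolding pushforward_def by auto
    fix f assume f: "f \<in> BDp p F"
    have "(\<lambda>x. f (\<phi> x)) \<in> BDp p E" using p by (intro BDp_pullback[OF _ E F(1,2) \<phi> f]) simp
    then have "continuous_map (product_topology (\<lambda>_. euclidean) (BDp p E)) (euclidean :: complex topology)
        (\<lambda>\<tau>. \<tau> (\<lambda>x. f (\<phi> x)))"
      by (rule continuous_map_product_projection)
    then show "continuous_map (harmonic_boundary_space p E v0) euclidean (\<lambda>\<tau>. pushforward p F \<phi> \<tau> f)"
      unfolding harmonic_boundary_space_def Sp_topology_def pushforward_def using f
      by (simp add: continuous_map_from_subtopology)
  qed
  then show ?thesis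
    unfolding harmonic_boundary_space_def[of p F] Sp_topology_def[of p F] continuous_map_in_subtopology
    using img sub by (auto simp: topspace_harmonic_boundary_space)
qed

text \<open>
  In general this identity fails for point evaluations, which move along \<open>\<psi> \<circ> \<phi>\<close>; it holds on the
  harmonic boundary because \<open>\<tau>\<close> vanishes on \<open>f \<circ> \<psi> \<circ> \<phi> - f\<close>.
\<close>

lemma pushforward_pushforward_id:
  assumes p: "0 < p" and E: "bounded_degree E" "sym E" and F: "bounded_degree F" "sym F"
    and \<phi>: "coarse_map E F \<phi>" and \<psi>: "coarse_map F E \<psi>"
    and close: "\<And>x. (x, \<psi> (\<phi> x)) \<in> (E\<^sup>=) ^^ N"
    and \<tau>: "\<tau> \<in> harmonic_boundary p E v0"
  shows "pushforward p E \<psi> (pushforward p F \<phi> \<tau>) = \<tau>"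
proof (rule extensionalityI[of _ "BDp p E"])
  have p': "0 \<le> p" using p by simp
  have \<tau>': "\<tau> \<in> Sp p E" "\<forall>f\<in>B_closure_finsupp p E v0. \<tau> f = 0"
    using \<tau> unfolding harmonic_boundary_iff[OF p E] by auto
  show "pushforward p E \<psi> (pushforward p F \<phi> \<tau>) \<in> extensional (BDp p E)" unfolding pushforward_def by simp
  show "\<tau> \<in> extensional (BDp p E)" using \<tau>'(1) unfolding Sp_def by blast
  fix f assume f: "f \<in> BDp p E"
  have f\<psi>: "(\<lambda>y. f (\<psi> y)) \<in> BDp p F" by (rule BDp_pullback[OF p' F E \<psi> f])
  let ?g = "\<lambda>x. f (\<psi> (\<phi> x)) - f x"
  have g: "?g \<in> B_closure_finsupp p E v0" by (rule diff_displaced_B_closure[OF p E close f])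
  then have gB: "?g \<in> BDp p E" by (rule B_closure_finsupp_in_BDp)
  have "\<tau> (\<lambda>x. ?g x + f x) = \<tau> ?g + \<tau> f"
    by (rule Sp_add[OF \<tau>'(1) gB f])
  then have "\<tau> (\<lambda>x. f (\<psi> (\<phi> x))) = \<tau> f" using \<tau>'(2) g by simp
  then show "pushforward p E \<psi> (pushforward p F \<phi> \<tau>) f = \<tau> f"
    unfolding pushforward_def using f f\<psi> by simp
qed

lemma homeomorphic_harmonic_boundary_if_coarse_inverse:
  assumes p: "0 < p" and E: "bounded_degree E" "sym E" "connected_graph E"
    and F: "bounded_degree F" "sym F" "connected_graph F"
    and \<phi>: "coarse_map E F \<phi>" and \<psi>: "coarse_map F E \<psi>"
    and "\<And>x. (x, \<psi> (\<phi> x)) \<in> (E\<^sup>=) ^^ N" and "\<And>y. (y, \<phi> (\<psi> y)) \<in> (F\<^sup>=) ^^ M"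
  shows "harmonic_boundary_space p E v0 homeomorphic_space harmonic_boundary_space p F w0"
  unfolding homeomorphic_space_def homeomorphic_maps_def topspace_harmonic_boundary_space
proof (intro exI conjI ballI)
  show "continuous_map (harmonic_boundary_space p E v0) (harmonic_boundary_space p F w0) (pushforward p F \<phi>)"
    by (rule continuous_map_pushforward[OF p E(1,2) F \<phi>])
  show "continuous_map (harmonic_boundary_space p F w0) (harmonic_boundary_space p E v0) (pushforward p E \<psi>)"
    by (rule continuous_map_pushforward[OF p F(1,2) E \<psi>])
  show "pushforward p E \<psi> (pushforward p F \<phi> \<tau>) = \<tau>" if "\<tau> \<in> harmonic_boundary p E v0" for \<tau>
    by (rule pushforward_pushforward_id[OF p E(1,2) F(1,2) \<phi> \<psi> assms(10) that])
  show "pushforward p F \<phi> (pushforward p E \<psi> \<sigma>) = \<sigma>" if "\<sigma> \<in> harmonic_boundary p F w0" for \<sigma>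
    by (rule pushforward_pushforward_id[OF p F(1,2) E(1,2) \<psi> \<phi> assms(11) that])
qed

section \<open>Rough isometries\<close>

lemma coarse_mapI:
  assumes E: "bounded_degree E" "connected_graph E" and F: "connected_graph F"
    and edge: "\<And>x y. (x, y) \<in> E \<Longrightarrow> path_dist F (\<phi> x) (\<phi> y) \<le> r"
    and fibre: "\<And>x y. \<phi> x = \<phi> y \<Longrightarrow> path_dist E x y \<le> s"
  shows "coarse_map E F \<phi>"
  unfolding coarse_map_def
proof
  show "\<exists>N. \<forall>x y. (x, y) \<in> E \<longrightarrow> (\<phi> x, \<phi> y) \<in> (F\<^sup>=) ^^ N"
    using path_dist_le_imp_reflcl_relpow[OF F edge] by blast
  obtain m where m: "\<And>x. finite (((E\<^sup>=) ^^ nat \<lceil>s\<rceil>) `` {x}) \<and> card (((E\<^sup>=) ^^ nat \<lceil>s\<rceil>) `` {x}) \<le> m"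
    using finite_ball[OF E(1)] by blast
  have "finite {x \<in> UNIV. \<phi> x = z} \<and> card {x \<in> UNIV. \<phi> x = z} \<le> m" for z
  proof (cases "\<exists>x. \<phi> x = z")
    case True
    then obtain x where "\<phi> x = z" by blast
    then have "{x \<in> UNIV. \<phi> x = z} \<subseteq> ((E\<^sup>=) ^^ nat \<lceil>s\<rceil>) `` {x}"
      using path_dist_le_imp_reflcl_relpow[OF E(2) fibre] by auto
    then show ?thesis using m[of x] by (meson card_mono finite_subset le_trans)
  qed auto
  then show "bounded_fibres UNIV \<phi>" unfolding bounded_fibres_def by blast
qed

text \<open>
  The rough inverse sends \<open>y\<close> to some \<open>x\<close> with \<open>\<phi> x\<close> within distance \<open>c\<close> of \<open>y\<close>.  All estimates
  in \<open>E\<close> come from the lower bound of the rough isometry, which turns a bound on the distance of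
  images under \<open>\<phi>\<close> into one on the distance of the points themselves.
\<close>

lemma rough_isometry_coarse_inverse:
  assumes E: "bounded_degree E" "sym E" "connected_graph E"
    and F: "bounded_degree F" "sym F" "connected_graph F"
    and \<phi>: "rough_isometry (path_dist E) (path_dist F) \<phi>"
  obtains \<psi> N M where "coarse_map E F \<phi>" "coarse_map F E \<psi>"
    "\<And>x. (x, \<psi> (\<phi> x)) \<in> (E\<^sup>=) ^^ N" "\<And>y. (y, \<phi> (\<psi> y)) \<in> (F\<^sup>=) ^^ M"
proof -
  let ?d = "path_dist E" and ?e = "path_dist F"
  obtain a b c where ab: "a \<ge> 1" "b \<ge> 0"
      and lower: "\<And>x1 x2. (1 / a) * ?d x1 x2 - b \<le> ?e (\<phi> x1) (\<phi> x2)"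
      and upper: "\<And>x1 x2. ?e (\<phi> x1) (\<phi> x2) \<le> a * ?d x1 x2 + b"
      and onto: "\<And>y. \<exists>x. ?e (\<phi> x) y < c"
    using \<phi> unfolding rough_isometry_def by metis
  obtain \<psi> where \<psi>: "\<And>y. ?e (\<phi> (\<psi> y)) y < c" using onto by metis
  have \<psi>': "?e y (\<phi> (\<psi> y)) < c" for y
    using \<psi>[of y] path_dist_commute_le[OF F(3,2), of y "\<phi> (\<psi> y)"] by linarith
  have lower': "?d x1 x2 \<le> a * (r + b)" if "?e (\<phi> x1) (\<phi> x2) \<le> r" for x1 x2 r
  proof -
    have "?d x1 x2 / a \<le> r + b" using lower[of x1 x2] that by simp
    then show ?thesis using ab by (simp add: field_simps)
  qed
  have "coarse_map E F \<phi>"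
  proof (rule coarse_mapI[OF E(1,3) F(3)])
    show "?e (\<phi> x) (\<phi> y) \<le> a * 1 + b" if "(x, y) \<in> E" for x y
    proof -
      have "?d x y \<le> 1" using path_dist_le[of x y 1 E] that by simp
      then have "a * ?d x y \<le> a * 1" using ab by (intro mult_left_mono) auto
      then show ?thesis using upper[of x y] by linarith
    qed
    show "?d x y \<le> a * (0 + b)" if "\<phi> x = \<phi> y" for x y
      using that path_dist_le[of "\<phi> y" "\<phi> y" 0 F] by (intro lower') simp
  qed
  moreover have "coarse_map F E \<psi>"
  proof (rule coarse_mapI[OF F(1,3) E(3)])
    show "?d (\<psi> x) (\<psi> y) \<le> a * ((c + (1 + c)) + b)" if "(x, y) \<in> F" for x y
    proof (rule lower')
      show "?e (\<phi> (\<psi> x)) (\<phi> (\<psi> y)) \<le> c + (1 + c)"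
        using path_dist_triangle[OF F(3), of "\<phi> (\<psi> x)" "\<phi> (\<psi> y)" x]
          path_dist_triangle[OF F(3), of x "\<phi> (\<psi> y)" y] \<psi>[of x] \<psi>'[of y] path_dist_le[of x y 1 F] that
        by simp
    qed
    show "?e x y \<le> c + c" if "\<psi> x = \<psi> y" for x y
      using path_dist_triangle[OF F(3), of x y "\<phi> (\<psi> x)"] \<psi>'[of x] \<psi>[of y] that by simp
  qed
  moreover have "(x, \<psi> (\<phi> x)) \<in> (E\<^sup>=) ^^ nat \<lceil>a * (c + b)\<rceil>" for x
    using \<psi>'[of "\<phi> x"] by (intro path_dist_le_imp_reflcl_relpow[OF E(3)] lower') simp
  moreover have "(y, \<phi> (\<psi> y)) \<in> (F\<^sup>=) ^^ nat \<lceil>c\<rceil>" for y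
    using \<psi>'[of y] by (intro path_dist_le_imp_reflcl_relpow[OF F(3)]) simp
  ultimately show ?thesis by (rule that)
qed

theorem theorem2p8:
  fixes p :: real
    and G :: "('v \<times> 'v) set" and H :: "('w \<times> 'w) set"
    and oG :: 'v and oH :: 'w
  assumes "p > 1"
    and "countable (UNIV :: 'v set)" and "infinite (UNIV :: 'v set)"
    and "undirected G" and "no_self_loops G" and "connected_graph G" and "bounded_degree G"
    and "countable (UNIV :: 'w set)" and "infinite (UNIV :: 'w set)"
    and "undirected H" and "no_self_loops H" and "connected_graph H" and "bounded_degree H"
    and "\<exists>\<phi> :: 'v \<Rightarrow> 'w. rough_isometry (path_dist G) (path_dist H) \<phi>"
  shows "harmonic_boundary_space p G oG homeomorphic_space harmonic_boundary_space p H oH"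
proof -
  have p: "0 < p" using assms(1) by simp
  have G: "bounded_degree G" "sym G" "connected_graph G"
    and H: "bounded_degree H" "sym H" "connected_graph H"
    using assms unfolding undirected_def by auto
  obtain \<phi> :: "'v \<Rightarrow> 'w" where "rough_isometry (path_dist G) (path_dist H) \<phi>"
    using assms(14) by blast
  then obtain \<psi> N M where "coarse_map G H \<phi>" "coarse_map H G \<psi>"
    "\<And>x. (x, \<psi> (\<phi> x)) \<in> (G\<^sup>=) ^^ N" "\<And>y. (y, \<phi> (\<psi> y)) \<in> (H\<^sup>=) ^^ M"
    using rough_isometry_coarse_inverse[OF G H] by blast
  then show ?thesis by (rule homeomorphic_harmonic_boundary_if_coarse_inverse[OF p G H])
qed

end
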